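(* Let $X=[0,1]$ with its Lebesgue measurable sets and let $\mu$ be the Lebesgue measure on $X$. Let $\mathrm{S}_{\mathrm{L}}(a,b)=(a+b-1)_+$ and $a\star b=(a+b)\wedge 1$ for $a,b\in[0,1]$, and let $f(x)=g(x)=\tfrac12\sqrt{x}$ for $x\in[0,1]$. Then $f,g$ are comonotone, the condition $$\mathrm{S}_{\mathrm{L}}(a\star b,c)\le \big(\mathrm{S}_{\mathrm{L}}(a,c)\star b\big)\wedge\big(a\star \mathrm{S}_{\mathrm{L}}(b,c)\big)$$ holds for all $a,b,c\in[0,1]$, but $$\int_{\mathrm{S}_{\mathrm{L}},X}(f\star g)\,d\mu=0.25>0.125=\Big(\int_{\mathrm{S}_{\mathrm{L}},X}f\,d\mu\Big)\star\Big(\int_{\mathrm{S}_{\mathrm{L}},X}g\,d\mu\Big).$$ Consequently, the displayed condition is not sufficient for the Minkowski type inequality $\int_{\mathrm{S},X}(f\star g)\,d\mu\le\big(\int_{\mathrm{S},X}f\,d\mu\big)\star\big(\int_{\mathrm{S},X}g\,d\mu\big)$ for comonotone functions.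
   Context: $a\wedge b=\min\{a,b\}$, $a_+=\max\{a,0\}$. Functions $f,g$ are comonotone if $(f(x)-f(y))(g(x)-g(y))\ge0$ for all $x,y\in X$. $(f\star g)(x)=f(x)\star g(x)$. For $\mathrm{S}\colon[0,1]^2\to[0,1]$ a semicopula (a nondecreasing function with neutral element $1$), the seminormed fuzzy integral of a measurable $f\colon X\to[0,1]$ is $\int_{\mathrm{S},X}f\,d\mu:=\sup_{t\in[0,1]}\mathrm{S}\big(t,\mu(\{f\ge t\})\big)$. *)

theory Defs
  imports "HOL-Analysis.Analysis"
begin

text \<open>
  Operations on the unit interval are total functions on the reals; every condition on them is
  restricted to \<open>{0..1}\<close>. Likewise functions on a set \<open>X\<close> are only looked at on \<open>X\<close>.
\<close>

definition nondecreasing_unit_op :: "(real \<Rightarrow> real \<Rightarrow> real) \<Rightarrow> bool" where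
  "nondecreasing_unit_op T \<longleftrightarrow>
     (\<forall>a\<in>{0..1}. \<forall>b\<in>{0..1}. T a b \<in> {0..1}) \<and>
     (\<forall>a\<in>{0..1}. \<forall>a'\<in>{0..1}. \<forall>b\<in>{0..1}. \<forall>b'\<in>{0..1}. a \<le> a' \<longrightarrow> b \<le> b' \<longrightarrow> T a b \<le> T a' b')"

definition semicopula :: "(real \<Rightarrow> real \<Rightarrow> real) \<Rightarrow> bool" where
  "semicopula S \<longleftrightarrow> nondecreasing_unit_op S \<and> (\<forall>a\<in>{0..1}. S a 1 = a \<and> S 1 a = a)"

definition comonotone_on :: "'a set \<Rightarrow> ('a \<Rightarrow> real) \<Rightarrow> ('a \<Rightarrow> real) \<Rightarrow> bool" where
  "comonotone_on X f g \<longleftrightarrow> (\<forall>x\<in>X. \<forall>y\<in>X. (f x - f y) * (g x - g y) \<ge> 0)"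

text \<open>
  The set function \<open>\<mu>\<close> is meant to take values in \<open>{0..1}\<close>; then, for a semicopula \<open>S\<close>, the
  supremum is over a nonempty bounded set, hence a genuine one.
\<close>

definition seminormed_integral ::
  "(real \<Rightarrow> real \<Rightarrow> real) \<Rightarrow> 'a set \<Rightarrow> ('a set \<Rightarrow> real) \<Rightarrow> ('a \<Rightarrow> real) \<Rightarrow> real" where
  "seminormed_integral S X \<mu> f = (SUP t\<in>{0..1}. S t (\<mu> {x\<in>X. f x \<ge> t}))"

definition pointwise_op :: "(real \<Rightarrow> real \<Rightarrow> real) \<Rightarrow> ('a \<Rightarrow> real) \<Rightarrow> ('a \<Rightarrow> real) \<Rightarrow> 'a \<Rightarrow> real" where
  "pointwise_op T f g = (\<lambda>x. T (f x) (g x))"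

definition subdistributive_cond ::
  "(real \<Rightarrow> real \<Rightarrow> real) \<Rightarrow> (real \<Rightarrow> real \<Rightarrow> real) \<Rightarrow> bool" where
  "subdistributive_cond S T \<longleftrightarrow>
     (\<forall>a\<in>{0..1}. \<forall>b\<in>{0..1}. \<forall>c\<in>{0..1}. S (T a b) c \<le> min (T (S a c) b) (T a (S b c)))"

definition S_L :: "real \<Rightarrow> real \<Rightarrow> real" where
  "S_L a b = max (a + b - 1) 0"

definition bounded_sum :: "real \<Rightarrow> real \<Rightarrow> real" where
  "bounded_sum a b = min (a + b) 1"

end

theory Submission
  imports Defs
begin

text \<open>The seminormed integral for \<open>S_L\<close> scales quadratically on the family
  \<open>c * sqrt x\<close>, while \<open>bounded_sum\<close> is additive for small values. The
  level set of \<open>c * sqrt x\<close> at \<open>t\<close> is the interval from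
  \<open>(t / c)\<^sup>2\<close> to 1, so the integral is the maximum of
  \<open>t - (t / c)\<^sup>2\<close>, namely \<open>c\<^sup>2 / 4\<close>
  (\<open>seminormed_integral_S_L_scaled_sqrt\<close>). Adding \<open>f\<close> and \<open>g\<close>
  doubles \<open>c\<close> from 1/2 to 1: the integral of the sum is 1/4, but the two integrals,
  1/16 each, add up to only 1/8.\<close>

lemma semicopula_S_L: "semicopula S_L"
  unfolding semicopula_def nondecreasing_unit_op_def S_L_def by auto

lemma nondecreasing_unit_op_bounded_sum: "nondecreasing_unit_op bounded_sum"
  unfolding nondecreasing_unit_op_def bounded_sum_def by auto

text \<open>If the left side is positive, it is at most \<open>a + b + c - 1\<close>, and moving
  \<open>b\<close> (or \<open>a\<close>) outside the positive part can only increase this; it is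
  also at most \<open>c \<le> 1\<close>, so the cap at 1 on the right does no harm.\<close>

lemma subdistributive_cond_S_L_bounded_sum: "subdistributive_cond S_L bounded_sum"
  unfolding subdistributive_cond_def S_L_def bounded_sum_def
  by (auto simp: min_def max_def)

lemma superlevel_set_scaled_sqrt:
  fixes c t :: real
  assumes "0 < c" "0 \<le> t"
  shows "{x \<in> {0..1}. c * sqrt x \<ge> t} = {(t / c)\<^sup>2..1}"
proof -
  have "c * sqrt x \<ge> t \<longleftrightarrow> (t / c)\<^sup>2 \<le> x" if "0 \<le> x" for x
  proof -
    have "c * sqrt x \<ge> t \<longleftrightarrow> t / c \<le> sqrt x"
      using assms by (simp add: field_simps)
    also have "\<dots> \<longleftrightarrow> (t / c)\<^sup>2 \<le> x"
      using assms real_sqrt_le_iff[of "(t / c)\<^sup>2" x] by simp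
    finally show ?thesis .
  qed
  moreover have "0 \<le> x" if "(t / c)\<^sup>2 \<le> x" for x
    using that by (rule order_trans[OF zero_le_power2])
  ultimately show ?thesis by auto
qed

text \<open>Only the values of \<open>h\<close> on the unit interval are prescribed, so that the
  lemma covers \<open>f\<close>, \<open>g\<close> and their pointwise sum alike.\<close>

lemma seminormed_integral_S_L_scaled_sqrt:
  fixes c :: real
  assumes c: "0 < c" "c \<le> 1" and h: "\<And>x. x \<in> {0..1} \<Longrightarrow> h x = c * sqrt x"
  shows "seminormed_integral S_L {0..1} (measure (lebesgue_on {0..1})) h = c\<^sup>2 / 4"
proof -
  \<comment> \<open>The \<open>max\<close> covers \<open>t > c\<close>, where the level set is
    empty.\<close>
  have level: "measure (lebesgue_on {0..1}) {x \<in> {0..1}. h x \<ge> t} = max (1 - (t / c)\<^sup>2) 0"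
    if "t \<in> {0..1}" for t
  proof -
    have "{x \<in> {0..1}. h x \<ge> t} = {x \<in> {0..1}. c * sqrt x \<ge> t}"
      using h by auto
    also have "\<dots> = {(t / c)\<^sup>2..1}"
      using c that by (intro superlevel_set_scaled_sqrt) auto
    finally have "{x \<in> {0..1}. h x \<ge> t} = {(t / c)\<^sup>2..1}" .
    moreover have "{(t / c)\<^sup>2..1} \<subseteq> {0..1}"
      by (auto intro: order_trans[OF zero_le_power2])
    ultimately show ?thesis
      by (simp add: measure_restrict_space)
  qed
  \<comment> \<open>Completing the square: \<open>t - (t / c)\<^sup>2 = c\<^sup>2 / 4 - (t / c - c / 2)\<^sup>2\<close>.\<close>
  have val: "S_L t (measure (lebesgue_on {0..1}) {x \<in> {0..1}. h x \<ge> t}) =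
      max (c\<^sup>2 / 4 - (t / c - c / 2)\<^sup>2) 0" if t: "t \<in> {0..1}" for t
  proof -
    have "c\<^sup>2 / 4 - (t / c - c / 2)\<^sup>2 = t - (t / c)\<^sup>2"
      using c by (simp add: power2_eq_square field_simps)
    \<comment> \<open>The inner truncation is absorbed by the outer one: where the level set has
      measure 0, \<open>S_L\<close> sees \<open>t - 1 \<le> 0\<close>.\<close>
    then show ?thesis
      using t unfolding level[OF t] S_L_def by (auto simp: max_def)
  qed
  show ?thesis
    unfolding seminormed_integral_def
  proof (rule cSup_eq_maximum)
    \<comment> \<open>The vertex of the parabola, where the square in \<open>val\<close> vanishes;
      \<open>c \<le> 1\<close> keeps it in the range of the supremum.\<close>
    have t: "c\<^sup>2 / 2 \<in> {0..1}"
      using c power_le_one[of c 2] by simp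
    have "c\<^sup>2 / 2 / c = c / 2"
      using c by (simp add: power2_eq_square)
    then have "c\<^sup>2 / 4 = S_L (c\<^sup>2 / 2) (measure (lebesgue_on {0..1}) {x \<in> {0..1}. h x \<ge> c\<^sup>2 / 2})"
      unfolding val[OF t] by (simp only:) simp
    with t show "c\<^sup>2 / 4 \<in> (\<lambda>t. S_L t (measure (lebesgue_on {0..1}) {x \<in> {0..1}. h x \<ge> t})) ` {0..1}"
      by (rule rev_image_eqI)
  next
    fix y
    assume "y \<in> (\<lambda>t. S_L t (measure (lebesgue_on {0..1}) {x \<in> {0..1}. h x \<ge> t})) ` {0..1}"
    then obtain t where "y = max (c\<^sup>2 / 4 - (t / c - c / 2)\<^sup>2) 0"
      using val by auto
    moreover have "0 \<le> (t / c - c / 2)\<^sup>2" "0 \<le> c\<^sup>2"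
      by simp_all
    ultimately show "y \<le> c\<^sup>2 / 4"
      by linarith
  qed
qed

theorem mainTheorem2:
  fixes X :: "real set" and \<mu> :: "real set \<Rightarrow> real" and f g :: "real \<Rightarrow> real"
  assumes X: "X = {0..1}"
    and mu: "\<mu> = measure (lebesgue_on X)"
    and f: "\<And>x. x \<in> X \<Longrightarrow> f x = 1 / 2 * sqrt x"
    and g: "\<And>x. x \<in> X \<Longrightarrow> g x = 1 / 2 * sqrt x"
  shows "semicopula S_L \<and> nondecreasing_unit_op bounded_sum
    \<and> f \<in> borel_measurable (lebesgue_on X) \<and> f \<in> X \<rightarrow> {0..1}
    \<and> g \<in> borel_measurable (lebesgue_on X) \<and> g \<in> X \<rightarrow> {0..1}
    \<and> comonotone_on X f g
    \<and> subdistributive_cond S_L bounded_sum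
    \<and> seminormed_integral S_L X \<mu> (pointwise_op bounded_sum f g) = 1 / 4
    \<and> (1 / 4 :: real) > 1 / 8
    \<and> bounded_sum (seminormed_integral S_L X \<mu> f) (seminormed_integral S_L X \<mu> g) = 1 / 8
    \<and> \<not> (\<forall>S T. semicopula S \<longrightarrow> nondecreasing_unit_op T \<longrightarrow> subdistributive_cond S T \<longrightarrow>
          (\<forall>u v. u \<in> borel_measurable (lebesgue_on X) \<longrightarrow> u \<in> X \<rightarrow> {0..1} \<longrightarrow>
                 v \<in> borel_measurable (lebesgue_on X) \<longrightarrow> v \<in> X \<rightarrow> {0..1} \<longrightarrow>
                 comonotone_on X u v \<longrightarrow>
                 seminormed_integral S X \<mu> (pointwise_op T u v)
                   \<le> T (seminormed_integral S X \<mu> u) (seminormed_integral S X \<mu> v)))"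
proof -
  have half_sqrt: "u \<in> borel_measurable (lebesgue_on X) \<and> u \<in> X \<rightarrow> {0..1}
      \<and> seminormed_integral S_L X \<mu> u = 1 / 16"
    if u: "\<And>x. x \<in> X \<Longrightarrow> u x = 1 / 2 * sqrt x" for u :: "real \<Rightarrow> real"
  proof (intro conjI)
    have "continuous_on X u"
      using u by (subst continuous_on_cong[OF refl, of _ _ "\<lambda>x. 1 / 2 * sqrt x"])
        (auto intro!: continuous_intros)
    then show "u \<in> borel_measurable (lebesgue_on X)"
      unfolding X by (rule continuous_imp_measurable_on_sets_lebesgue) simp
    show "u \<in> X \<rightarrow> {0..1}"
    proof
      fix x
      assume x: "x \<in> X"
      then have "0 \<le> sqrt x" "sqrt x \<le> 1"
        by (simp_all add: X)
      then show "u x \<in> {0..1}"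
        unfolding u[OF x] atLeastAtMost_iff by linarith
    qed
    show "seminormed_integral S_L X \<mu> u = 1 / 16"
      using seminormed_integral_S_L_scaled_sqrt[of "1 / 2" u] u
      by (simp add: X mu power2_eq_square)
  qed
  have comonotone: "comonotone_on X f g"
    unfolding comonotone_on_def by (simp add: f g)
  \<comment> \<open>The cap at 1 is never active, since \<open>sqrt x \<le> 1\<close>; the factor 1
    exhibits the case \<open>c = 1\<close>.\<close>
  have sum: "pointwise_op bounded_sum f g x = 1 * sqrt x" if "x \<in> {0..1}" for x
    using that by (simp add: pointwise_op_def bounded_sum_def X f g)
  have integral_sum: "seminormed_integral S_L X \<mu> (pointwise_op bounded_sum f g) = 1 / 4"
    using seminormed_integral_S_L_scaled_sqrt[of 1, OF _ _ sum] by (simp add: X mu)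
  have sum_integrals:
    "bounded_sum (seminormed_integral S_L X \<mu> f) (seminormed_integral S_L X \<mu> g) = 1 / 8"
    using half_sqrt[OF f] half_sqrt[OF g] by (simp add: bounded_sum_def)
  \<comment> \<open>The instance \<open>S_L\<close>, \<open>bounded_sum\<close>, \<open>f\<close>,
    \<open>g\<close> that refutes the universal claim.\<close>
  have fails: "\<not> seminormed_integral S_L X \<mu> (pointwise_op bounded_sum f g)
      \<le> bounded_sum (seminormed_integral S_L X \<mu> f) (seminormed_integral S_L X \<mu> g)"
    unfolding integral_sum sum_integrals by simp
  show ?thesis
    using semicopula_S_L nondecreasing_unit_op_bounded_sum subdistributive_cond_S_L_bounded_sum
      half_sqrt[OF f] half_sqrt[OF g] comonotone integral_sum sum_integrals fails
    by (intro conjI) (assumption | blast | simp)+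
qed

end
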